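(* Let $m,n\ge 1$ be integers and let $X=[x_{ij}]$ be an $m\times n$ real matrix. Then \[ (m-2)n\sum_{i=1}^m\sum_{j=1}^n x_{ij}^2+n\sum_{j=1}^n\left(\sum_{i=1}^m x_{ij}\right)^2\ \ge\ \left(\sum_{i=1}^m\sum_{j=1}^n x_{ij}\right)^2+(m-2)\sum_{i=1}^m\left(\sum_{j=1}^n x_{ij}\right)^2, \] and \[ m(n-2)\sum_{i=1}^m\sum_{j=1}^n x_{ij}^2+m\sum_{i=1}^m\left(\sum_{j=1}^n x_{ij}\right)^2\ \ge\ \left(\sum_{i=1}^m\sum_{j=1}^n x_{ij}\right)^2+(n-2)\sum_{j=1}^n\left(\sum_{i=1}^m x_{ij}\right)^2. \] *)

theory Defs
  imports "HOL-Analysis.Finite_Cartesian_Product"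
begin

end

theory Submission
  imports Defs
begin

text \<open>
  For a family \<open>a\<close> indexed by a set \<open>B\<close> of \<open>n\<close> elements, \<open>n * (\<Sum>a\<^sup>2) - (\<Sum>a)\<^sup>2\<close> is half the
  sum of the squared differences \<open>(a j - a k)\<^sup>2\<close> over all ordered pairs (lemma
  \<open>sum_squared_differences\<close>). Apply this to every row of \<open>X\<close>, with weight \<open>m - 2\<close>, and to the
  family of column sums: twice the difference of the two sides of the first inequality becomes a
  sum over pairs \<open>(j, k)\<close> of columns of
  \<open>(m - 2) * (\<Sum>i. (d i)\<^sup>2) + (\<Sum>i. d i)\<^sup>2\<close>, where \<open>d i = x i j - x i k\<close>.
  Each such term is nonnegative: this is clear for \<open>m \<ge> 2\<close>, and for \<open>m = 1\<close> its two parts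
  cancel (lemma \<open>weighted_squares_nonneg\<close>). The second inequality is the first one for the
  transposed matrix.
\<close>

text \<open>
  Lagrange's identity for \<open>a\<close> and the constant family \<open>1\<close>: the right-hand side is twice the
  defect in the Cauchy-Schwarz inequality.
\<close>

lemma sum_squared_differences:
  fixes a :: "'b \<Rightarrow> real"
  shows "(\<Sum>j\<in>B. \<Sum>k\<in>B. (a j - a k)\<^sup>2)
         = 2 * (real (card B) * (\<Sum>j\<in>B. (a j)\<^sup>2) - (\<Sum>j\<in>B. a j)\<^sup>2)"
proof -
  have "(\<Sum>j\<in>B. \<Sum>k\<in>B. (a j - a k)\<^sup>2)
      = (\<Sum>j\<in>B. real (card B) * (a j)\<^sup>2 + (\<Sum>k\<in>B. (a k)\<^sup>2) - 2 * a j * (\<Sum>k\<in>B. a k))"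
    by (simp add: power2_diff sum.distrib sum_subtractf sum_distrib_left)
  also have "\<dots> = 2 * (real (card B) * (\<Sum>j\<in>B. (a j)\<^sup>2) - (\<Sum>j\<in>B. a j)\<^sup>2)"
    by (simp add: sum.distrib sum_subtractf power2_eq_square right_diff_distrib mult.assoc
        flip: sum_distrib_left sum_distrib_right)
  finally show ?thesis .
qed

text \<open>
  The coefficient \<open>card A - 2\<close> is negative only for at most one summand, and then the square of
  the sum is the sum of the squares.
\<close>

lemma weighted_squares_nonneg:
  fixes d :: "'a \<Rightarrow> real"
  assumes "finite A"
  shows "0 \<le> (real (card A) - 2) * (\<Sum>i\<in>A. (d i)\<^sup>2) + (\<Sum>i\<in>A. d i)\<^sup>2"
proof (cases "card A \<ge> 2")
  case True
  then show ?thesis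
    by (intro add_nonneg_nonneg mult_nonneg_nonneg sum_nonneg) auto
next
  case False
  then consider "card A = 0" | "card A = 1"
    by linarith
  then show ?thesis
  proof cases
    case 1
    with assms show ?thesis by simp
  next
    case 2
    then obtain i where "A = {i}" by (auto simp: card_1_singleton_iff)
    then show ?thesis by simp
  qed
qed

text \<open>
  Both terms with factor \<open>card A - 2\<close> come from Lagrange's identity in the rows and the other two
  from Lagrange's identity for the column sums. The weighted bound is then used for each
  difference of two columns.
\<close>

lemma row_column_sum_inequality:
  fixes x :: "'a \<Rightarrow> 'b \<Rightarrow> real"
  assumes "finite A"
  shows "(\<Sum>i\<in>A. \<Sum>j\<in>B. x i j)\<^sup>2 + (real (card A) - 2) * (\<Sum>i\<in>A. (\<Sum>j\<in>B. x i j)\<^sup>2)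
         \<le> (real (card A) - 2) * real (card B) * (\<Sum>i\<in>A. \<Sum>j\<in>B. (x i j)\<^sup>2)
           + real (card B) * (\<Sum>j\<in>B. (\<Sum>i\<in>A. x i j)\<^sup>2)"
proof -
  let ?c = "real (card A) - 2" and ?n = "real (card B)"
  have rows: "(\<Sum>j\<in>B. \<Sum>k\<in>B. \<Sum>i\<in>A. (x i j - x i k)\<^sup>2)
      = 2 * (?n * (\<Sum>i\<in>A. \<Sum>j\<in>B. (x i j)\<^sup>2) - (\<Sum>i\<in>A. (\<Sum>j\<in>B. x i j)\<^sup>2))"
  proof -
    have "(\<Sum>j\<in>B. \<Sum>k\<in>B. \<Sum>i\<in>A. (x i j - x i k)\<^sup>2)
        = (\<Sum>j\<in>B. \<Sum>i\<in>A. \<Sum>k\<in>B. (x i j - x i k)\<^sup>2)"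
      by (intro sum.cong refl sum.swap)
    also have "\<dots> = (\<Sum>i\<in>A. \<Sum>j\<in>B. \<Sum>k\<in>B. (x i j - x i k)\<^sup>2)"
      by (rule sum.swap)
    also have "\<dots> = 2 * (?n * (\<Sum>i\<in>A. \<Sum>j\<in>B. (x i j)\<^sup>2) - (\<Sum>i\<in>A. (\<Sum>j\<in>B. x i j)\<^sup>2))"
      by (simp add: sum_squared_differences sum_subtractf flip: sum_distrib_left)
    finally show ?thesis .
  qed
  have columns: "(\<Sum>j\<in>B. \<Sum>k\<in>B. (\<Sum>i\<in>A. x i j - x i k)\<^sup>2)
      = 2 * (?n * (\<Sum>j\<in>B. (\<Sum>i\<in>A. x i j)\<^sup>2) - (\<Sum>i\<in>A. \<Sum>j\<in>B. x i j)\<^sup>2)"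
    using sum_squared_differences[of "\<lambda>j. \<Sum>i\<in>A. x i j" B]
    by (simp add: sum_subtractf sum.swap[of "\<lambda>j i. x i j" A B])
  have "0 \<le> (\<Sum>j\<in>B. \<Sum>k\<in>B. ?c * (\<Sum>i\<in>A. (x i j - x i k)\<^sup>2) + (\<Sum>i\<in>A. x i j - x i k)\<^sup>2)"
    by (intro sum_nonneg weighted_squares_nonneg assms)
  also have "\<dots> = ?c * (\<Sum>j\<in>B. \<Sum>k\<in>B. \<Sum>i\<in>A. (x i j - x i k)\<^sup>2)
      + (\<Sum>j\<in>B. \<Sum>k\<in>B. (\<Sum>i\<in>A. x i j - x i k)\<^sup>2)"
    by (simp add: sum.distrib flip: sum_distrib_left)
  finally show ?thesis
    unfolding rows columns by (simp add: algebra_simps)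
qed

theorem corollary5p1:
  fixes X :: "real ^ 'n ^ 'm"
  shows "(real CARD('m) - 2) * real CARD('n) * (\<Sum>i\<in>UNIV. \<Sum>j\<in>UNIV. (X $ i $ j)\<^sup>2)
           + real CARD('n) * (\<Sum>j\<in>UNIV. (\<Sum>i\<in>UNIV. X $ i $ j)\<^sup>2)
         \<ge> (\<Sum>i\<in>UNIV. \<Sum>j\<in>UNIV. X $ i $ j)\<^sup>2
           + (real CARD('m) - 2) * (\<Sum>i\<in>UNIV. (\<Sum>j\<in>UNIV. X $ i $ j)\<^sup>2)
       \<and> real CARD('m) * (real CARD('n) - 2) * (\<Sum>i\<in>UNIV. \<Sum>j\<in>UNIV. (X $ i $ j)\<^sup>2)
           + real CARD('m) * (\<Sum>i\<in>UNIV. (\<Sum>j\<in>UNIV. X $ i $ j)\<^sup>2)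
         \<ge> (\<Sum>i\<in>UNIV. \<Sum>j\<in>UNIV. X $ i $ j)\<^sup>2
           + (real CARD('n) - 2) * (\<Sum>j\<in>UNIV. (\<Sum>i\<in>UNIV. X $ i $ j)\<^sup>2)"
proof (intro conjI)
  let ?x = "\<lambda>i j. X $ i $ j"
  show "(\<Sum>i\<in>UNIV. \<Sum>j\<in>UNIV. ?x i j)\<^sup>2
      + (real CARD('m) - 2) * (\<Sum>i\<in>UNIV. (\<Sum>j\<in>UNIV. ?x i j)\<^sup>2)
      \<le> (real CARD('m) - 2) * real CARD('n) * (\<Sum>i\<in>UNIV. \<Sum>j\<in>UNIV. (?x i j)\<^sup>2)
        + real CARD('n) * (\<Sum>j\<in>UNIV. (\<Sum>i\<in>UNIV. ?x i j)\<^sup>2)"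
    by (rule row_column_sum_inequality) simp
  have "(\<Sum>i\<in>UNIV. \<Sum>j\<in>UNIV. ?x i j) = (\<Sum>j\<in>UNIV. \<Sum>i\<in>UNIV. ?x i j)"
    and "(\<Sum>i\<in>UNIV. \<Sum>j\<in>UNIV. (?x i j)\<^sup>2) = (\<Sum>j\<in>UNIV. \<Sum>i\<in>UNIV. (?x i j)\<^sup>2)"
    by (rule sum.swap)+
  then show "(\<Sum>i\<in>UNIV. \<Sum>j\<in>UNIV. ?x i j)\<^sup>2
      + (real CARD('n) - 2) * (\<Sum>j\<in>UNIV. (\<Sum>i\<in>UNIV. ?x i j)\<^sup>2)
      \<le> real CARD('m) * (real CARD('n) - 2) * (\<Sum>i\<in>UNIV. \<Sum>j\<in>UNIV. (?x i j)\<^sup>2)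
        + real CARD('m) * (\<Sum>i\<in>UNIV. (\<Sum>j\<in>UNIV. ?x i j)\<^sup>2)"
    using row_column_sum_inequality[of "UNIV :: 'n set" "\<lambda>j i. ?x i j" "UNIV :: 'm set"]
    by (simp add: mult.commute[of "real CARD('m)" "real CARD('n) - 2"])
qed

end
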